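(* Let $p,q$ be distinct primes and let $G$ be a group of order $p^2q^2$. Then the difference graph $D(G)$ is perfect.
   Context: For a group $G$, the power graph $\mathsf{Pow}(G)$ has vertex set $G$, with distinct $a,b$ adjacent iff $a\in\langle b\rangle$ or $b\in\langle a\rangle$. The enhanced power graph $\mathsf{EPow}(G)$ has vertex set $G$, with distinct $a,b$ adjacent iff $\langle a,b\rangle$ is cyclic. The difference graph $D(G)$ is the graph $\mathsf{EPow}(G)-\mathsf{Pow}(G)$ with all isolated vertices removed; thus $x\sim y$ in $D(G)$ iff $\langle x,y\rangle$ is cyclic, $x\notin\langle y\rangle$ and $y\notin\langle x\rangle$. *)

theory Defs
  imports "HOL-Algebra.Algebra" "HOL-Library.Ramsey"
begin

section \<open>Perfect graphs\<close>

text \<open>A simple graph has as edges two-element sets of vertices, so that the predicates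
  \<^const>\<open>clique\<close> and \<^const>\<open>indep\<close> of the library apply to its edge set.\<close>

record 'a ugraph =
  vertices :: "'a set"
  edges :: "'a set set"

definition simple_graph :: "'a ugraph \<Rightarrow> bool" where
  "simple_graph \<Gamma> \<longleftrightarrow> edges \<Gamma> \<subseteq> nsets (vertices \<Gamma>) 2"

definition induced :: "'a ugraph \<Rightarrow> 'a set \<Rightarrow> 'a ugraph" where
  "induced \<Gamma> S = \<lparr>vertices = S, edges = {e \<in> edges \<Gamma>. e \<subseteq> S}\<rparr>"

definition proper_colouring :: "'a ugraph \<Rightarrow> nat \<Rightarrow> ('a \<Rightarrow> nat) \<Rightarrow> bool" where
  "proper_colouring \<Gamma> k c \<longleftrightarrow>
     c ` vertices \<Gamma> \<subseteq> {..<k} \<and>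
     (\<forall>x\<in>vertices \<Gamma>. \<forall>y\<in>vertices \<Gamma>. {x, y} \<in> edges \<Gamma> \<longrightarrow> c x \<noteq> c y)"

text \<open>The next three notions are meant for finite simple graphs: for infinite ones the
  minimum and the maximum below need not exist.\<close>

definition chromatic_number :: "'a ugraph \<Rightarrow> nat" where
  "chromatic_number \<Gamma> = (LEAST k. \<exists>c. proper_colouring \<Gamma> k c)"

definition clique_number :: "'a ugraph \<Rightarrow> nat" where
  "clique_number \<Gamma> = Max {card K |K. K \<subseteq> vertices \<Gamma> \<and> clique K (edges \<Gamma>)}"

definition perfect_graph :: "'a ugraph \<Rightarrow> bool" where
  "perfect_graph \<Gamma> \<longleftrightarrow>
     (\<forall>S \<subseteq> vertices \<Gamma>. chromatic_number (induced \<Gamma> S) = clique_number (induced \<Gamma> S))"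

section \<open>Graphs of a group\<close>

definition power_graph :: "('a, 'b) monoid_scheme \<Rightarrow> 'a ugraph" where
  "power_graph G = \<lparr>vertices = carrier G,
     edges = {{a, b} |a b. a \<in> carrier G \<and> b \<in> carrier G \<and> a \<noteq> b \<and>
                (a \<in> generate G {b} \<or> b \<in> generate G {a})}\<rparr>"

definition enhanced_power_graph :: "('a, 'b) monoid_scheme \<Rightarrow> 'a ugraph" where
  "enhanced_power_graph G = \<lparr>vertices = carrier G,
     edges = {{a, b} |a b. a \<in> carrier G \<and> b \<in> carrier G \<and> a \<noteq> b \<and>
                cyclic_group (subgroup_generated G {a, b})}\<rparr>"

definition delete_edges :: "'a ugraph \<Rightarrow> 'a ugraph \<Rightarrow> 'a ugraph" where
  "delete_edges \<Gamma> \<Delta> = \<lparr>vertices = vertices \<Gamma>, edges = edges \<Gamma> - edges \<Delta>\<rparr>"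

definition remove_isolated :: "'a ugraph \<Rightarrow> 'a ugraph" where
  "remove_isolated \<Gamma> = induced \<Gamma> {v \<in> vertices \<Gamma>. \<exists>e\<in>edges \<Gamma>. v \<in> e}"

definition difference_graph :: "('a, 'b) monoid_scheme \<Rightarrow> 'a ugraph" where
  "difference_graph G = remove_isolated (delete_edges (enhanced_power_graph G) (power_graph G))"

lemma simple_difference_graph: "simple_graph (difference_graph G)"
  by (auto simp: simple_graph_def difference_graph_def remove_isolated_def induced_def
      delete_edges_def enhanced_power_graph_def nsets_def)

lemma difference_graph_adj_iff:
  "{x, y} \<in> edges (difference_graph G) \<longleftrightarrow>
     x \<in> carrier G \<and> y \<in> carrier G \<and> cyclic_group (subgroup_generated G {x, y}) \<and>
     x \<notin> generate G {y} \<and> y \<notin> generate G {x}" (is "?L \<longleftrightarrow> ?R")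
proof -
  have epow: "{x, y} \<in> edges (enhanced_power_graph G) \<longleftrightarrow> x \<in> carrier G \<and> y \<in> carrier G \<and>
      x \<noteq> y \<and> cyclic_group (subgroup_generated G {x, y})"
    by (auto simp: enhanced_power_graph_def doubleton_eq_iff insert_commute)
  have pow: "{x, y} \<in> edges (power_graph G) \<longleftrightarrow> x \<in> carrier G \<and> y \<in> carrier G \<and>
      x \<noteq> y \<and> (x \<in> generate G {y} \<or> y \<in> generate G {x})"
    by (auto simp: power_graph_def doubleton_eq_iff)
  have "?L \<longleftrightarrow> {x, y} \<in> edges (enhanced_power_graph G) \<and> {x, y} \<notin> edges (power_graph G)"
    using epow by (auto simp: difference_graph_def remove_isolated_def induced_def delete_edges_def
        enhanced_power_graph_def doubleton_eq_iff)
  also have "\<dots> \<longleftrightarrow> ?R"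
    unfolding epow pow by (auto intro: generate.incl)
  finally show ?thesis .
qed

end

theory Submission
  imports Defs
begin

text \<open>Elements of order \<open>p^a q^b\<close> are split according to whether \<open>b < a\<close>, \<open>a < b\<close> or
  \<open>a = b\<close>. Within a class the orders form a chain for divisibility, and elements of a cyclic
  group with comparable orders generate comparable subgroups, so \<open>D(G)\<close> is tripartite. If an
  element \<open>m\<close> of the third class has neighbours \<open>x\<close> and \<open>y\<close> in the first and the second, the
  orders of \<open>m, x, y\<close> are \<open>pq, p\<^sup>2, q\<^sup>2\<close>. Then \<open>G = \<langle>x\<rangle>\<langle>y\<rangle>\<close>, and both
  \<open>x^p\<close> and \<open>y^q\<close> are powers of \<open>m\<close>, hence central in \<open>G\<close>; this forces \<open>x\<close> and \<open>y\<close> to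
  commute, so \<open>m, x, y\<close> is a triangle. An induced subgraph therefore either contains a triangle
  and has a colouring with three colours, or is bipartite: each vertex of the third class can be
  given the colour of the class in which it has no neighbour.\<close>

context group
begin

section \<open>Products of powers of two elements of coprime order\<close>

lemma eq_one_of_coprime_int_pow:
  fixes a b :: int
  assumes z: "z \<in> carrier G" and "z [^] a = \<one>" "z [^] b = \<one>" "coprime a b"
  shows "z = \<one>"
proof -
  have "int (ord z) dvd 1"
    using assms by (metis coprime_def int_pow_eq_id)
  then show ?thesis
    using ord_eq_1[OF z] by simp
qed

text \<open>Comparing the two sides gives an element of \<langle>x\<rangle> that also lies in
  \<langle>y\<rangle>. It is killed by both orders, so it is trivial.\<close>

lemma int_pow_mult_left_cancel_coprime:
  fixes i j i' j' :: int
  assumes x: "x \<in> carrier G" and y: "y \<in> carrier G" and co: "coprime (ord x) (ord y)"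
    and eq: "x [^] i \<otimes> y [^] j = x [^] i' \<otimes> y [^] j'"
  shows "x [^] i = x [^] i'" and "y [^] j = y [^] j'"
proof -
  have "inv (x [^] i') \<otimes> (x [^] i \<otimes> y [^] j) = y [^] j'"
    unfolding eq using x y by (simp flip: m_assoc)
  then have "x [^] (i - i') \<otimes> y [^] j = y [^] j'"
    using x y int_pow_mult[OF x, of "-i'" i] by (simp add: int_pow_neg m_assoc)
  then have w: "x [^] (i - i') = y [^] (j' - j)"
    using x y by (metis int_pow_closed int_pow_diff inv_solve_right)
  have "(x [^] (i - i')) [^] (int (ord x)) = \<one>"
    using x by (simp add: int_pow_pow int_pow_eq_id)
  moreover have "(x [^] (i - i')) [^] (int (ord y)) = \<one>"
    unfolding w using y by (simp add: int_pow_pow int_pow_eq_id)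
  ultimately have 1: "x [^] (i - i') = \<one>"
    using eq_one_of_coprime_int_pow co x by (metis coprime_int_iff int_pow_closed)
  then show "x [^] i = x [^] i'"
    using x by (metis dvd_diff_commute int_pow_eq int_pow_eq_id)
  show "y [^] j = y [^] j'"
    using y 1 w by (metis int_pow_eq int_pow_eq_id)
qed

text \<open>By counting: the products with exponents below the orders are pairwise distinct, and
  there are \<open>ord x * ord y = order G\<close> of them.\<close>

lemma carrier_eq_int_pow_mult:
  assumes fin: "finite (carrier G)" and x: "x \<in> carrier G" and y: "y \<in> carrier G"
    and co: "coprime (ord x) (ord y)" and ord: "ord x * ord y = order G"
    and g: "g \<in> carrier G"
  shows "\<exists>(i::int) (j::int). g = x [^] i \<otimes> y [^] j"
proof -
  let ?f = "\<lambda>(i::nat, j::nat). x [^] int i \<otimes> y [^] int j"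
  let ?A = "{..<ord x} \<times> {..<ord y}"
  have pow_inj: "m = n" if "z \<in> carrier G" "z [^] int m = z [^] int n" "m < ord z" "n < ord z"
    for z and m n :: nat
  proof -
    have "int (ord z) dvd int n - int m"
      using that by (simp add: int_pow_eq)
    then have "int n mod int (ord z) = int m mod int (ord z)"
      by (simp add: mod_eq_dvd_iff)
    then show ?thesis
      using that by simp
  qed
  have "inj_on ?f ?A"
  proof (rule inj_onI, clarsimp)
    fix i j i' j' :: nat
    assume b: "i < ord x" "j < ord y" "i' < ord x" "j' < ord y"
      and "x [^] int i \<otimes> y [^] int j = x [^] int i' \<otimes> y [^] int j'"
    then have "x [^] int i = x [^] int i'" "y [^] int j = y [^] int j'"
      using int_pow_mult_left_cancel_coprime[OF x y co] by blast+
    then show "i = i' \<and> j = j'"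
      using pow_inj x y b by blast
  qed
  then have "card (?f ` ?A) = card (carrier G)"
    using ord by (simp add: card_image card_cartesian_product order_def)
  moreover have "?f ` ?A \<subseteq> carrier G"
    using x y by auto
  ultimately have "?f ` ?A = carrier G"
    using fin by (simp add: card_subset_eq)
  then have "g \<in> ?f ` ?A"
    using g by simp
  then obtain i j where "g = x [^] int i \<otimes> y [^] int j"
    by auto
  then show ?thesis
    by blast
qed

section \<open>Conjugation, and commuting generators of cyclic Sylow subgroups\<close>

lemma conj_int_pow:
  fixes n :: int
  assumes "x \<in> carrier G" "y \<in> carrier G"
  shows "(inv x \<otimes> y \<otimes> x) [^] n = inv x \<otimes> y [^] n \<otimes> x"
proof -
  have "(\<lambda>y. inv x \<otimes> y \<otimes> x) \<in> hom G G"
    using assms by (auto simp: hom_def m_assoc) (simp flip: m_assoc)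
  then show ?thesis
    using assms hom_int_pow[of "\<lambda>y. inv x \<otimes> y \<otimes> x" G G y n] is_group by simp
qed

lemma int_pow_commute:
  fixes n :: int
  assumes "x \<in> carrier G" "y \<in> carrier G" "x \<otimes> y = y \<otimes> x"
  shows "x [^] n \<otimes> y = y \<otimes> x [^] n"
proof -
  have "inv y \<otimes> x \<otimes> y = x"
    using assms by (metis inv_solve_left m_assoc inv_closed m_closed)
  then have "inv y \<otimes> x [^] n \<otimes> y = x [^] n"
    using conj_int_pow[of y x n] assms by simp
  then show ?thesis
    using assms by (metis inv_solve_left m_assoc inv_closed m_closed int_pow_closed)
qed

text \<open>The main point is that the conjugate \<open>y'\<close> of \<open>y\<close> by
  \<open>x\<close> lies in \<langle>y\<rangle>; the assumption \<open>p < q\<close> enters through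
  the pigeonhole principle. Then \<open>xy\<close> puts the commutator of \<open>x\<close> and
  \<open>y\<close> into the subgroup generated by \<open>y [^] int q\<close>, and \<open>yx\<close>
  makes its \<open>p\<close>-th power trivial.\<close>

lemma cyclic_sylow_generators_commute_aux:
  fixes p q :: nat
  assumes p: "Factorial_Ring.prime p" and q: "Factorial_Ring.prime q" and pq: "p < q"
    and order: "order G = p\<^sup>2 * q\<^sup>2"
    and x: "x \<in> carrier G" "ord x = p\<^sup>2" and y: "y \<in> carrier G" "ord y = q\<^sup>2"
    and xy: "x \<otimes> y [^] int q = y [^] int q \<otimes> x" and yx: "y \<otimes> x [^] int p = x [^] int p \<otimes> y"
  shows "x \<otimes> y = y \<otimes> x"
proof -
  have co: "coprime p q"
    using primes_coprime[OF p q] pq by simp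
  have fin: "finite (carrier G)"
  proof -
    have "order G > 0"
      unfolding order using prime_gt_0_nat[OF p] prime_gt_0_nat[OF q] by simp
    then show ?thesis
      using order_gt_0_iff_finite by blast
  qed
  have dec: "\<exists>(i::int) (j::int). g = x [^] i \<otimes> y [^] j" if "g \<in> carrier G" for g
  proof -
    have "coprime (ord x) (ord y)" "ord x * ord y = order G"
      unfolding order x(2) y(2) using co by simp_all
    from carrier_eq_int_pow_mult[OF fin x(1) y(1) this that] show ?thesis .
  qed
  define y' where "y' = inv x \<otimes> y \<otimes> x"
  have y': "y' \<in> carrier G"
    using x y by (simp add: y'_def)
  have y'_pow: "y' [^] n = inv x \<otimes> y [^] n \<otimes> x" for n :: int
    unfolding y'_def using x y by (simp add: conj_int_pow)
  have "\<forall>k::nat. \<exists>(i::int) (j::int). y' [^] int k = x [^] i \<otimes> y [^] j"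
    using dec[OF int_pow_closed[OF y']] by blast
  from choice[OF this] obtain I :: "nat \<Rightarrow> int" where
    I: "\<forall>k. \<exists>j::int. y' [^] int k = x [^] I k \<otimes> y [^] j" ..
  text \<open>The powers of \<open>y'\<close> meet at most \<open>p < q\<close> classes of exponents of \<open>x\<close> modulo \<open>p\<close>.\<close>
  have "\<not> inj_on (\<lambda>k. I k mod int p) {..<q}"
  proof
    assume inj: "inj_on (\<lambda>k. I k mod int p) {..<q}"
    have "(\<lambda>k. I k mod int p) ` {..<q} \<subseteq> {0..<int p}"
      using prime_gt_0_nat[OF p] by auto
    then have "card {..<q} \<le> card {0..<int p}"
      using inj by (intro card_inj_on_le) auto
    then show False
      using pq by simp
  qed
  then obtain k l where kl: "k < l" "l < q" "I k mod int p = I l mod int p"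
    by (metis (no_types, lifting) inj_onI lessThan_iff nat_neq_iff)
  then obtain t where t: "I l - I k = int p * t"
    by (metis dvd_def mod_eq_dvd_iff)
  obtain j j' :: int where j: "y' [^] int k = x [^] I k \<otimes> y [^] j" and j': "y' [^] int l = x [^] I l \<otimes> y [^] j'"
    using I by blast
  \<comment> \<open>Dividing the two powers of \<open>y'\<close> leaves \<open>y' [^] d\<close> with
    \<open>0 < d < q\<close>. Its \<open>x\<close> part has an exponent divisible by
    \<open>p\<close>, so it commutes with \<open>y\<close>.\<close>
  define d where "d = int l - int k"
  have c: "(x [^] int p) [^] n \<otimes> y = y \<otimes> (x [^] int p) [^] n" for n :: int
    using int_pow_commute[of "x [^] int p" y n] x y yx by simp
  have cc: "(x [^] (int p * t)) \<otimes> y [^] m = y [^] m \<otimes> x [^] (int p * t)" for m :: int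
    using c[of t] x y int_pow_commute[of y "x [^] (int p * t)" m] by (simp add: int_pow_pow)
  have "y' [^] d = inv (y' [^] int k) \<otimes> y' [^] int l"
    using int_pow_mult[OF y', of "- int k" "int l"] y' by (simp add: d_def int_pow_neg)
  also have "\<dots> = y [^] (-j) \<otimes> (x [^] (- I k) \<otimes> x [^] I l) \<otimes> y [^] j'"
    unfolding j j' using x y by (simp add: inv_mult_group m_assoc int_pow_neg)
  also have "x [^] (- I k) \<otimes> x [^] I l = x [^] (int p * t)"
    using x t by (simp flip: int_pow_mult)
  also have "y [^] (-j) \<otimes> x [^] (int p * t) \<otimes> y [^] j' = x [^] (int p * t) \<otimes> y [^] (j' - j)"
    using x y by (simp add: m_assoc flip: cc int_pow_mult)
  \<comment> \<open>The \<open>p\<close>-th power removes the \<open>x\<close> part, since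
    \<open>ord x = p\<^sup>2\<close>; what remains is a power of \<open>y\<close>.\<close>
  finally have "y' [^] (d * int p) = (x [^] (int p * t) \<otimes> y [^] (j' - j)) [^] int p"
    using y' by (simp flip: int_pow_pow)
  also have "\<dots> = (x [^] (int p * t)) [^] int p \<otimes> (y [^] (j' - j)) [^] int p"
    using x y cc by (intro int_pow_mult_distrib) auto
  also have "(x [^] (int p * t)) [^] int p = \<one>"
    using x by (simp add: int_pow_pow int_pow_eq_id power2_eq_square)
  finally have dp: "y' [^] (d * int p) = y [^] ((j' - j) * int p)"
    using y by (simp add: int_pow_pow)
  have "\<not> int q dvd d"
    using kl by (auto simp: d_def dest!: zdvd_imp_le)
  then have "coprime d (int q)"
    using q by (simp add: coprime_commute[of d] prime_imp_coprime)
  then have "coprime (d * int p) ((int q)\<^sup>2)"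
    using co by simp
  \<comment> \<open>Here \<open>e\<close> inverts \<open>d * int p\<close> modulo
    \<open>ord y\<close>. As \<open>y'\<close> is a conjugate of \<open>y\<close>, raising to the
    power \<open>e\<close> recovers \<open>y'\<close> itself as a power of \<open>y\<close>.\<close>
  then obtain e f where "e * (d * int p) + f * (int q)\<^sup>2 = 1"
    by (metis bezout_int coprime_imp_gcd_eq_1)
  then have "1 - d * int p * e = (int q)\<^sup>2 * f"
    by (simp add: algebra_simps)
  then have e: "int (ord y) dvd 1 - d * int p * e"
    using y by simp
  have "y' [^] (d * int p * e) = y'"
    unfolding y'_pow using e x y int_pow_eq[OF y(1), of "d * int p * e" 1] by (simp add: y'_def)
  then have "y' = y [^] ((j' - j) * int p * e)"
    using dp y y' by (metis int_pow_pow)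
  then obtain m :: int where m: "y' = y [^] m" by blast
  \<comment> \<open>Conjugation by \<open>x\<close> fixes \<open>y [^] int q\<close>, so
    \<open>m * q\<close> and \<open>q\<close> agree modulo \<open>q\<^sup>2\<close>, that is,
    \<open>m\<close> is 1 modulo \<open>q\<close>.\<close>
  have "y [^] (m * int q) = y' [^] int q"
    using y m by (simp add: int_pow_pow)
  also have "\<dots> = y [^] int q"
    using x y by (simp add: y'_pow m_assoc flip: xy) (simp flip: m_assoc)
  finally have "(int q)\<^sup>2 dvd int q - m * int q"
    using y by (simp add: int_pow_eq)
  also have "int q - m * int q = int q * (1 - m)"
    by (simp add: algebra_simps)
  finally have "int q dvd m - 1"
    using q by (auto simp: power2_eq_square dvd_diff_commute)
  then obtain s where s: "m - 1 = int q * s" by blast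
  text \<open>The commutator \<open>z\<close> of \<open>x\<close> and \<open>y\<close> commutes with both and is killed by \<open>p\<close> and by \<open>q\<close>.\<close>
  define z where "z = y [^] (m - 1)"
  have z: "z \<in> carrier G"
    using y by (simp add: z_def)
  have zx: "z \<otimes> x = x \<otimes> z"
    using int_pow_commute[of "y [^] int q" x s] x y xy by (simp add: z_def s int_pow_pow)
  have y'z: "y \<otimes> x = x \<otimes> (y \<otimes> z)"
  proof -
    have "y \<otimes> z = y'"
      using y int_pow_mult[OF y(1), of 1 "m - 1"] by (simp add: z_def m)
    moreover have "x \<otimes> y' = y \<otimes> x"
      unfolding y'_def using x y by (simp flip: m_assoc)
    ultimately show ?thesis
      by simp
  qed
  \<comment> \<open>Moving \<open>y\<close> past \<open>x [^] n\<close> costs a factor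
    \<open>z [^] n\<close>, because \<open>z\<close> commutes with \<open>x\<close>. At
    \<open>n = p\<close> the power of \<open>x\<close> commutes with \<open>y\<close>, which forces
    \<open>z [^] p = \<one>\<close>.\<close>
  have "y \<otimes> x [^] n = x [^] n \<otimes> (y \<otimes> z [^] n)" for n :: nat
  proof (induction n)
    case (Suc n)
    have "y \<otimes> x [^] Suc n = x [^] n \<otimes> (y \<otimes> z [^] n) \<otimes> x"
      using Suc x y by (simp flip: m_assoc)
    also have "\<dots> = x [^] n \<otimes> (y \<otimes> x) \<otimes> z [^] n"
      using x y z group_commutes_pow[OF zx z x(1), of n] by (simp add: m_assoc)
    also have "\<dots> = x [^] Suc n \<otimes> (y \<otimes> z [^] Suc n)"
      using x y z nat_pow_Suc2[OF z] by (simp add: y'z m_assoc)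
    finally show ?case .
  qed (use y in simp)
  from this[of p] have "y \<otimes> z [^] p = y"
    using x y z yx by (metis int_pow_int l_cancel m_closed nat_pow_closed)
  then have "z [^] int p = \<one>"
    using y z by (simp add: int_pow_int)
  moreover have "z [^] int q = \<one>"
    using y by (simp add: z_def s int_pow_pow int_pow_eq_id power2_eq_square)
  ultimately have "z = \<one>"
    using z co eq_one_of_coprime_int_pow[of z "int p" "int q"] by simp
  then show ?thesis
    using y'z y by simp
qed

lemma cyclic_sylow_generators_commute:
  fixes p q :: nat
  assumes p: "Factorial_Ring.prime p" and q: "Factorial_Ring.prime q" and "p \<noteq> q"
    and order: "order G = p\<^sup>2 * q\<^sup>2"
    and x: "x \<in> carrier G" "ord x = p\<^sup>2" and y: "y \<in> carrier G" "ord y = q\<^sup>2"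
    and xy: "x \<otimes> y [^] int q = y [^] int q \<otimes> x" and yx: "y \<otimes> x [^] int p = x [^] int p \<otimes> y"
  shows "x \<otimes> y = y \<otimes> x"
proof (cases "p < q")
  case True
  then show ?thesis
    using cyclic_sylow_generators_commute_aux[OF p q _ order x y xy yx] by blast
next
  case False
  then have "q < p"
    using \<open>p \<noteq> q\<close> by simp
  moreover have "order G = q\<^sup>2 * p\<^sup>2"
    using order by (simp add: mult.commute)
  ultimately show ?thesis
    using cyclic_sylow_generators_commute_aux[OF q p _ _ y x yx xy] by metis
qed

section \<open>Pairs of elements in a common cyclic subgroup\<close>

lemma cyclic_group_pairE:
  assumes "x \<in> carrier G" "y \<in> carrier G" "cyclic_group (subgroup_generated G {x, y})"
  obtains z and i j :: int where "z \<in> carrier G" "x = z [^] i" "y = z [^] j"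
proof -
  let ?H = "subgroup_generated G {x, y}"
  obtain z where z: "z \<in> carrier ?H" and H: "carrier ?H = range (\<lambda>n::int. z [^]\<^bsub>?H\<^esub> n)"
    using assms group.cyclic_group[OF group_subgroup_generated] by blast
  have "carrier ?H = range (\<lambda>n::int. z [^] n)"
    unfolding H using int_pow_subgroup_generated[OF z] by simp
  moreover have "x \<in> carrier ?H" "y \<in> carrier ?H"
    using assms by (auto simp: carrier_subgroup_generated intro: generate.incl)
  ultimately obtain i j :: int where "x = z [^] i" "y = z [^] j"
    by blast
  moreover have "z \<in> carrier G"
    using z carrier_subgroup_generated_subset by blast
  ultimately show thesis
    using that by blast
qed

text \<open>Orders decide inclusion between subgroups of \<langle>z\<rangle>: \<open>z [^] j\<close>
  generates the same subgroup as \<open>z [^] g\<close>, where \<open>g\<close> is the gcd of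
  \<open>j\<close> and \<open>ord z\<close>, and divisibility of the orders forces \<open>g\<close>
  to divide \<open>i\<close>.\<close>

lemma int_pow_mem_generate_int_pow:
  fixes i j :: int
  assumes fin: "finite (carrier G)" and z: "z \<in> carrier G" and dvd: "ord (z [^] i) dvd ord (z [^] j)"
  shows "z [^] i \<in> generate G {z [^] j}"
proof -
  define N where "N = int (ord z)"
  have N: "N > 0"
    using ord_ge_1[OF fin z] by (simp add: N_def)
  define g where "g = gcd j N"
  have g: "g > 0" "g dvd j" "g dvd N"
    using N by (auto simp: g_def)
  \<comment> \<open>Thus \<open>N div g\<close> is a multiple of the order of
    \<open>z [^] j\<close>, and therefore of the order of \<open>z [^] i\<close>.\<close>
  have "(z [^] j) [^] (N div g) = \<one>"
  proof -
    have "N dvd j * (N div g)"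
      using g by (metis div_mult_swap dvd_div_mult dvd_triv_right)
    then show ?thesis
      using z by (simp add: int_pow_pow int_pow_eq_id N_def)
  qed
  then have "int (ord (z [^] i)) dvd N div g"
    using z dvd by (meson dvd_trans int_dvd_int_iff int_pow_closed int_pow_eq_id)
  then have "(z [^] i) [^] (N div g) = \<one>"
    using z by (simp add: int_pow_eq_id)
  then have "N dvd i * (N div g)"
    using z by (simp add: int_pow_pow int_pow_eq_id N_def)
  moreover have "N = g * (N div g)" "N div g \<noteq> 0"
    using g N by auto
  ultimately have "g dvd i"
    by (metis dvd_mult_cancel_right)
  then obtain r where r: "i = g * r" ..
  obtain s t where "s * j + t * N = g"
    unfolding g_def using bezout_int by blast
  then have "j * (s * r) - i = N * (- t * r)"
    unfolding r by (auto simp: algebra_simps)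
  then have "N dvd j * (s * r) - i" by simp
  then have "z [^] i = (z [^] j) [^] (s * r)"
    using z by (simp add: int_pow_pow int_pow_eq N_def)
  then show ?thesis
    using z generate_pow[of "z [^] j"] by auto
qed

text \<open>Bezout supplies exponents that are 1 modulo one order and 0 modulo the other. They
  extract \<open>x\<close> and \<open>y\<close> as powers of \<open>x \<otimes> y\<close>, which
  therefore generates the same subgroup as the pair.\<close>

lemma cyclic_group_pairI:
  assumes x: "x \<in> carrier G" and y: "y \<in> carrier G" and xy: "x \<otimes> y = y \<otimes> x"
    and co: "coprime (ord x) (ord y)"
  shows "cyclic_group (subgroup_generated G {x, y})"
proof -
  let ?z = "x \<otimes> y"
  obtain a b where ab: "a * int (ord x) + b * int (ord y) = 1"
    using co by (metis bezout_int coprime_imp_gcd_eq_1 coprime_int_iff)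
  have pow: "?z [^] n = x [^] n \<otimes> y [^] n" for n :: int
    using int_pow_mult_distrib xy x y by blast
  have "x [^] (b * int (ord y)) = x [^] (1::int)"
    using x ab unfolding int_pow_eq[OF x] by (metis add_diff_cancel_right' dvd_triv_right)
  then have zx: "?z [^] (b * int (ord y)) = x"
    using x y int_pow_eq_id[OF y, of "b * int (ord y)"] by (simp add: pow)
  have "y [^] (a * int (ord x)) = y [^] (1::int)"
    using y ab unfolding int_pow_eq[OF y] by (metis add_diff_cancel_left' dvd_triv_right)
  then have zy: "?z [^] (a * int (ord x)) = y"
    using x y int_pow_eq_id[OF x, of "a * int (ord x)"] by (simp add: pow)
  have "x \<in> generate G {?z}" "y \<in> generate G {?z}"
    using zx zy generate_pow[of ?z] x y by (metis (mono_tags, lifting) m_closed mem_Collect_eq rangeI UNIV_I)+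
  then have "generate G {x, y} \<subseteq> generate G {?z}"
    using x y by (intro generate_subgroup_incl generate_is_subgroup) auto
  moreover have "generate G {?z} \<subseteq> generate G {x, y}"
    using x y by (intro generate_subgroup_incl generate_is_subgroup) (auto intro: generate.intros)
  ultimately have "subgroup_generated G {x, y} = subgroup_generated G {?z}"
    using x y by (simp add: subgroup_generated_def)
  then show ?thesis
    by (simp add: cyclic_group_generated)
qed

section \<open>Neighbours and triangles in the difference graph\<close>

text \<open>Neighbours are powers of one element \<open>z\<close>, so they commute, and comparable
  orders would place one in the subgroup generated by the other. The last claim is what turns
  \<open>x [^] int p\<close> and \<open>y [^] int q\<close> into powers of a common neighbour
  \<open>m\<close>.\<close>

lemma difference_graph_adjD:
  fixes k :: int
  assumes fin: "finite (carrier G)" and xy: "{x, y} \<in> edges (difference_graph G)"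
  shows "\<not> ord x dvd ord y" "\<not> ord y dvd ord x" "x \<otimes> y = y \<otimes> x"
    and "ord (x [^] k) dvd ord y \<Longrightarrow> x [^] k \<in> generate G {y}"
proof -
  note adj = xy[unfolded difference_graph_adj_iff]
  then obtain z and i j :: int where z: "z \<in> carrier G" "x = z [^] i" "y = z [^] j"
    using cyclic_group_pairE by blast
  show "\<not> ord x dvd ord y" "\<not> ord y dvd ord x"
    using adj z int_pow_mem_generate_int_pow[OF fin z(1)] by auto
  show "x \<otimes> y = y \<otimes> x"
    unfolding z using z by (metis add.commute int_pow_mult)
  show "ord (x [^] k) dvd ord y \<Longrightarrow> x [^] k \<in> generate G {y}"
    unfolding z using z(1) int_pow_mem_generate_int_pow[OF fin z(1)] by (simp add: int_pow_pow)
qed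

lemma difference_graph_triangle:
  fixes p q :: nat
  assumes p: "Factorial_Ring.prime p" and q: "Factorial_Ring.prime q" and "p \<noteq> q"
    and order: "order G = p\<^sup>2 * q\<^sup>2"
    and mx: "{m, x} \<in> edges (difference_graph G)" and my: "{m, y} \<in> edges (difference_graph G)"
    and m: "ord m = p * q" and x: "ord x = p\<^sup>2" and y: "ord y = q\<^sup>2"
  shows "{x, y} \<in> edges (difference_graph G)"
proof -
  have car: "m \<in> carrier G" "x \<in> carrier G" "y \<in> carrier G"
    using mx my by (auto simp: difference_graph_adj_iff)
  have pos: "p > 0" "q > 0"
    using p q by (auto simp: prime_gt_0_nat)
  have "order G > 0"
    unfolding order using pos by simp
  then have fin: "finite (carrier G)"
    using order_gt_0_iff_finite by blast
  have comm: "m \<otimes> x = x \<otimes> m" "m \<otimes> y = y \<otimes> m"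
    using difference_graph_adjD(3)[OF fin] mx my by blast+
  have "ord (x [^] int p) dvd ord m"
    using ord_pow[of x p] car x m pos by (simp add: int_pow_int power2_eq_square)
  then have "x [^] int p \<in> generate G {m}"
    using difference_graph_adjD(4)[OF fin] mx by (simp add: insert_commute)
  then obtain k :: int where k: "x [^] int p = m [^] k"
    using generate_pow[OF car(1)] by auto
  have "ord (y [^] int q) dvd ord m"
    using ord_pow[of y q] car y m pos by (simp add: int_pow_int power2_eq_square)
  then have "y [^] int q \<in> generate G {m}"
    using difference_graph_adjD(4)[OF fin] my by (simp add: insert_commute)
  then obtain l :: int where l: "y [^] int q = m [^] l"
    using generate_pow[OF car(1)] by auto
  have xy: "x \<otimes> y = y \<otimes> x"
  proof (rule cyclic_sylow_generators_commute[OF p q \<open>p \<noteq> q\<close> order car(2) x car(3) y])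
    show "x \<otimes> y [^] int q = y [^] int q \<otimes> x"
      unfolding l using int_pow_commute[OF car(1,2) comm(1)] by simp
    show "y \<otimes> x [^] int p = x [^] int p \<otimes> y"
      unfolding k using int_pow_commute[OF car(1,3) comm(2)] by simp
  qed
  have co: "coprime (ord x) (ord y)"
    unfolding x y using primes_coprime[OF p q \<open>p \<noteq> q\<close>] by simp
  \<comment> \<open>This rules out an edge of the power graph between \<open>x\<close> and
    \<open>y\<close>: their orders are coprime and different from 1.\<close>
  have ord1: "ord v = 1" if v: "v \<in> generate G {w}" and co: "coprime (ord v) (ord w)" and w: "w \<in> carrier G" for v w
  proof -
    obtain k :: int where k: "v = w [^] k"
      using v generate_pow[OF w] by auto
    have "v \<in> carrier G" "v [^] int (ord w) = \<one>"
      unfolding k using w by (simp_all add: int_pow_pow int_pow_eq_id)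
    then have "ord v dvd ord w"
      by (simp add: int_pow_eq_id)
    then show ?thesis
      using co by (metis coprime_common_divisor_nat dvd_refl)
  qed
  have "ord x \<noteq> 1" "ord y \<noteq> 1"
    unfolding x y using p q by (auto simp: power2_eq_square)
  then have "x \<notin> generate G {y}" "y \<notin> generate G {x}"
    using ord1[of x y] ord1[of y x] co car by (auto simp: coprime_commute)
  then show ?thesis
    using cyclic_group_pairI[OF car(2,3) xy co] car by (simp add: difference_graph_adj_iff)
qed

end

section \<open>Colourings, cliques and perfect graphs\<close>

lemma card_clique_le_colours:
  assumes "proper_colouring \<Gamma> k c" "K \<subseteq> vertices \<Gamma>" "clique K (edges \<Gamma>)"
  shows "card K \<le> k"
proof -
  have "c v \<noteq> c w" if "v \<in> K" "w \<in> K" "v \<noteq> w" for v w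
  proof -
    have "{v, w} \<in> edges \<Gamma>" "v \<in> vertices \<Gamma>" "w \<in> vertices \<Gamma>"
      using that assms(2,3) by (auto simp: clique_def)
    then show ?thesis
      using assms(1) by (simp add: proper_colouring_def)
  qed
  then have "inj_on c K"
    by (meson inj_onI)
  moreover have "c ` K \<subseteq> {..<k}"
    using assms by (auto simp: proper_colouring_def)
  ultimately show ?thesis
    using card_inj_on_le[of c K "{..<k}"] by simp
qed

text \<open>Every proper colouring has at least as many colours as any clique has vertices, so a
  colouring and a clique of equal size determine both numbers. Perfection is proved by exhibiting
  such a pair for each induced subgraph.\<close>

lemma chromatic_eq_clique_number:
  assumes fin: "finite (vertices \<Gamma>)" and c: "proper_colouring \<Gamma> (card K) c"
    and K: "K \<subseteq> vertices \<Gamma>" "clique K (edges \<Gamma>)"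
  shows "chromatic_number \<Gamma> = clique_number \<Gamma>"
proof -
  have "chromatic_number \<Gamma> = card K"
    unfolding chromatic_number_def using c card_clique_le_colours[OF _ K]
    by (intro Least_equality) auto
  moreover have "clique_number \<Gamma> = card K"
    unfolding clique_number_def
  proof (rule Max_eqI)
    have "{card K |K. K \<subseteq> vertices \<Gamma> \<and> clique K (edges \<Gamma>)} \<subseteq> card ` Pow (vertices \<Gamma>)"
      by auto
    then show "finite {card K |K. K \<subseteq> vertices \<Gamma> \<and> clique K (edges \<Gamma>)}"
      using fin finite_subset by blast
  qed (use K card_clique_le_colours[OF c] in auto)
  ultimately show ?thesis by simp
qed

lemma perfect_graph_of_tripartition:
  assumes fin: "finite (vertices \<Gamma>)" and c: "proper_colouring \<Gamma> 3 c"
    and tri: "\<And>x y m. \<lbrakk>c x = 0; c y = 1; c m = 2; {m, x} \<in> edges \<Gamma>; {m, y} \<in> edges \<Gamma>\<rbrakk>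
      \<Longrightarrow> {x, y} \<in> edges \<Gamma>"
  shows "perfect_graph \<Gamma>"
  unfolding perfect_graph_def
proof (intro allI impI)
  fix S assume S: "S \<subseteq> vertices \<Gamma>"
  let ?E = "edges \<Gamma>"
  have vert [simp]: "vertices (induced \<Gamma> S) = S"
    and edge [simp]: "{x, y} \<in> edges (induced \<Gamma> S) \<longleftrightarrow> {x, y} \<in> ?E \<and> x \<in> S \<and> y \<in> S" for x y
    by (auto simp: induced_def)
  have finS: "finite (vertices (induced \<Gamma> S))"
    using S fin finite_subset by auto
  have c3: "c v = 0 \<or> c v = 1 \<or> c v = 2" if "v \<in> S" for v
  proof -
    have "c v < 3"
      using c S that unfolding proper_colouring_def by blast
    then show ?thesis by linarith
  qed
  have cE: "c v \<noteq> c w" if "v \<in> S" "w \<in> S" "{v, w} \<in> ?E" for v w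
    using c S that unfolding proper_colouring_def by blast
  note eqI = chromatic_eq_clique_number[OF finS]
  show "chromatic_number (induced \<Gamma> S) = clique_number (induced \<Gamma> S)"
  proof (cases "\<exists>x\<in>S. \<exists>y\<in>S. \<exists>m\<in>S. c x = 0 \<and> c y = 1 \<and> c m = 2 \<and> {m, x} \<in> ?E \<and> {m, y} \<in> ?E")
    case True
    then obtain x y m where xym: "x \<in> S" "y \<in> S" "m \<in> S" "c x = 0" "c y = 1" "c m = 2"
        "{m, x} \<in> ?E" "{m, y} \<in> ?E"
      by blast
    then have "{x, y} \<in> ?E"
      using tri by blast
    then have "clique {x, y, m} (edges (induced \<Gamma> S))"
      using xym by (auto simp: clique_def insert_commute)
    moreover have "card {x, y, m} = 3"
      using xym by (auto simp: card_insert_if)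
    moreover have "proper_colouring (induced \<Gamma> S) 3 c"
      using c S by (auto simp: proper_colouring_def)
    ultimately show ?thesis
      using xym by (intro eqI[of "{x, y, m}" c]) simp_all
  next
    case no_triangle: False
    show ?thesis
    proof (cases "\<exists>x\<in>S. \<exists>y\<in>S. {x, y} \<in> ?E")
      case True
      then obtain x y where xy: "x \<in> S" "y \<in> S" "{x, y} \<in> ?E"
        by blast
      \<comment> \<open>A vertex of colour 2 avoids colour 0 only if it sees that colour in
        \<open>S\<close>. In that case it sees no vertex of colour 1, because
        \<open>no_triangle\<close> holds.\<close>
      define c' where
        "c' v = (if c v = 2 then if \<exists>x\<in>S. c x = 0 \<and> {v, x} \<in> ?E then 1 else 0 else c v)" for v
      have lt: "c' v < 2" if "v \<in> S" for v
        using c3[OF that] by (auto simp: c'_def)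
      have ne2: "c' v \<noteq> c' w" if vw: "v \<in> S" "w \<in> S" "{v, w} \<in> ?E" and v: "c v = 2" for v w
      proof (cases "c w = 0")
        case True
        then have "c' v = 1"
          using vw v by (auto simp: c'_def)
        then show ?thesis
          using True by (simp add: c'_def)
      next
        case False
        then have w: "c w = 1"
          using c3[OF vw(2)] cE[OF vw] v by auto
        then have "\<not> (\<exists>x\<in>S. c x = 0 \<and> {v, x} \<in> ?E)"
          using no_triangle vw v by blast
        then have "c' v = 0"
          using v unfolding c'_def by simp
        then show ?thesis
          using w by (simp add: c'_def)
      qed
      have ne: "c' v \<noteq> c' w" if vw: "v \<in> S" "w \<in> S" "{v, w} \<in> ?E" for v w
      proof -
        have wv: "{w, v} \<in> ?E"
          using vw(3) by (simp add: insert_commute)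
        consider "c v = 2" | "c w = 2" | "c v \<noteq> 2" "c w \<noteq> 2"
          by blast
        then show ?thesis
        proof cases
          case 1
          then show ?thesis using ne2[OF vw] by blast
        next
          case 2
          then show ?thesis using ne2[OF vw(2,1) wv] by metis
        next
          case 3
          then show ?thesis using cE[OF vw] by (simp add: c'_def)
        qed
      qed
      have "card {x, y} = 2"
        using cE[OF xy] by (metis card_2_iff)
      moreover have "clique {x, y} (edges (induced \<Gamma> S))"
        using xy by (auto simp: clique_def insert_commute)
      moreover have "proper_colouring (induced \<Gamma> S) 2 c'"
        unfolding proper_colouring_def using lt ne by auto
      ultimately show ?thesis
        using xy by (intro eqI[of "{x, y}" c']) simp_all
    next
      case edgeless: False
      show ?thesis
      proof (cases "S = {}")
        case True
        \<comment> \<open>The empty subgraph is separate: its value is 0, certified by the empty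
          clique, whereas a nonempty edgeless one has value 1.\<close>
        have "proper_colouring (induced \<Gamma> S) 0 (\<lambda>_. 0)"
          unfolding proper_colouring_def vert by (simp add: True)
        then show ?thesis
          by (intro eqI[of "{}" "\<lambda>_. 0"]) simp_all
      next
        case False
        then obtain v where "v \<in> S"
          by blast
        moreover have "proper_colouring (induced \<Gamma> S) 1 (\<lambda>_. 0)"
          unfolding proper_colouring_def using edgeless by auto
        ultimately show ?thesis
          by (intro eqI[of "{v}" "\<lambda>_. 0"]) (simp_all add: clique_def)
      qed
    qed
  qed
qed

section \<open>Prime exponents of element orders, and the three classes\<close>

theorem theorem7p4:
  fixes G :: "('a, 'b) monoid_scheme" and p q :: nat
  assumes "Factorial_Ring.prime p" and "Factorial_Ring.prime q" and "p \<noteq> q"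
    and "group G" and "order G = p ^ 2 * q ^ 2"
  shows "perfect_graph (difference_graph G)"
proof -
  interpret group G by fact
  have "order G > 0"
    unfolding assms(5) using assms(1,2) by (simp add: prime_gt_0_nat)
  then have fin: "finite (carrier G)"
    using order_gt_0_iff_finite by blast
  have "\<exists>a b. a \<le> 2 \<and> b \<le> 2 \<and> ord x = p ^ a * q ^ b" if x: "x \<in> carrier G" for x
  proof -
    have "ord x dvd p ^ 2 * q ^ 2"
      using ord_dvd_group_order[OF x] by (simp add: assms(5))
    then obtain u v where "ord x = u * v" "u dvd p ^ 2" "v dvd q ^ 2"
      by (metis division_decomp)
    then show ?thesis
      using divides_primepow_nat assms(1,2) by metis
  qed
  then obtain a b where ab: "\<And>x. x \<in> carrier G \<Longrightarrow> a x \<le> 2 \<and> b x \<le> 2 \<and> ord x = p ^ a x * q ^ b x"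
    by metis
  text \<open>Each of the three classes below is a chain for divisibility of orders, hence independent.\<close>
  define c where "c x = (if b x < a x then 0 else if a x < b x then 1 else 2::nat)" for x
  \<comment> \<open>Neither order divides the other, so the exponent pairs of neighbours are
    incomparable in the product order.\<close>
  have incomparable: "x \<in> carrier G" "y \<in> carrier G" "a x < a y \<and> b y < b x \<or> a y < a x \<and> b x < b y"
    if "{x, y} \<in> edges (difference_graph G)" for x y
  proof -
    show xy: "x \<in> carrier G" "y \<in> carrier G"
      using that by (simp_all add: difference_graph_adj_iff)
    have "\<not> (a x \<le> a y \<and> b x \<le> b y)" "\<not> (a y \<le> a x \<and> b y \<le> b x)"
      using difference_graph_adjD(1,2)[OF fin that] ab[OF xy(1)] ab[OF xy(2)]
      by (metis le_imp_power_dvd mult_dvd_mono)+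
    then show "a x < a y \<and> b y < b x \<or> a y < a x \<and> b x < b y"
      by linarith
  qed
  have verts: "vertices (difference_graph G) \<subseteq> carrier G"
    by (auto simp: difference_graph_def remove_isolated_def induced_def delete_edges_def enhanced_power_graph_def)
  show ?thesis
  proof (rule perfect_graph_of_tripartition)
    show "finite (vertices (difference_graph G))"
      using verts fin finite_subset by blast
    show "proper_colouring (difference_graph G) 3 c"
      unfolding proper_colouring_def
    proof (intro conjI ballI impI)
      show "c ` vertices (difference_graph G) \<subseteq> {..<3}"
        by (auto simp: c_def)
      fix x y assume "{x, y} \<in> edges (difference_graph G)"
      note i = incomparable[OF this]
      show "c x \<noteq> c y"
        using i(3) ab[OF i(1)] ab[OF i(2)] by (auto simp: c_def)
    qed
    fix x y m
    assume c: "c x = 0" "c y = 1" "c m = 2"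
      and mx: "{m, x} \<in> edges (difference_graph G)" and my: "{m, y} \<in> edges (difference_graph G)"
    note ix = incomparable[OF mx] and iy = incomparable[OF my]
    have "b x < a x" "a y < b y" "a m = b m"
      using c by (auto simp: c_def split: if_splits)
    \<comment> \<open>With \<open>k = a m = b m\<close>, incomparability gives
      \<open>b x < k < a x\<close> and \<open>a y < k < b y\<close>; exponents are at most 2, so all
      six values are determined.\<close>
    then have "a m = 1" "b m = 1" "a x = 2" "b x = 0" "a y = 0" "b y = 2"
      using ix(3) iy(3) ab[OF ix(1)] ab[OF ix(2)] ab[OF iy(2)] by linarith+
    then have "ord m = p * q" "ord x = p\<^sup>2" "ord y = q\<^sup>2"
      using ab[OF ix(1)] ab[OF ix(2)] ab[OF iy(2)] by auto
    then show "{x, y} \<in> edges (difference_graph G)"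
      using difference_graph_triangle[OF assms(1-3,5) mx my] by blast
  qed
qed

end
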